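(* Let $G=(V,E)$ be a connected graph on $n=|V|$ vertices, having Laplacian matrix $L$ with eigenvalues $\lambda_1\ge\lambda_2\ge\cdots\ge\lambda_n(=0)$. For any given vertex subset $U=\{u_1,\ldots,u_m\}\subset V$ with $|U|=m$ and $0<m<n$, we have $$\sum_{i=1}^{m}\lambda_{n-i}\;\le\;\sum_{u\in U}d_u+\frac{|\partial(U,\overline{U})|}{n-m}\;\le\;\sum_{i=1}^{m}\lambda_i .$$
   Context: All graphs are finite and simple. The Laplacian matrix of $G$ is $L=D-A$, where $D$ is the diagonal matrix of vertex degrees and $A$ is the adjacency matrix; eigenvalues are listed with multiplicity. $d_u$ is the degree in $G$ of the vertex $u$. $\overline{U}=V\setminus U$, and $\partial(U,\overline{U})$ is the set of edges of $G$ connecting a vertex of $U$ with a vertex of $\overline{U}$. *)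

theory Defs
  imports Complex_Main "Jordan_Normal_Form.Char_Poly"
begin

definition simple_graph :: "'a set \<Rightarrow> 'a set set \<Rightarrow> bool" where
  "simple_graph V E \<longleftrightarrow> finite V \<and> (\<forall>e\<in>E. e \<subseteq> V \<and> card e = 2)"

definition connected_graph :: "'a set \<Rightarrow> 'a set set \<Rightarrow> bool" where
  "connected_graph V E \<longleftrightarrow> V \<noteq> {} \<and> (\<forall>u\<in>V. \<forall>v\<in>V. (u, v) \<in> {(x, y). {x, y} \<in> E}\<^sup>*)"

definition degree_in :: "'a set set \<Rightarrow> 'a \<Rightarrow> nat" where
  "degree_in E u = card {e \<in> E. u \<in> e}"

definition edges_between :: "'a set set \<Rightarrow> 'a set \<Rightarrow> 'a set \<Rightarrow> 'a set set" where
  "edges_between E U W = {e \<in> E. \<exists>u\<in>U. \<exists>w\<in>W. e = {u, w}}"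

text \<open>The list \<open>vs\<close> enumerates the vertices without repetition: rows and columns \<open>i\<close> of the
  following matrices belong to the vertex \<open>vs ! i\<close>.\<close>

definition degree_mat :: "'a set set \<Rightarrow> 'a list \<Rightarrow> real mat" where
  "degree_mat E vs = mat (length vs) (length vs)
     (\<lambda>(i, j). if i = j then real (degree_in E (vs ! i)) else 0)"

definition adjacency_mat :: "'a set set \<Rightarrow> 'a list \<Rightarrow> real mat" where
  "adjacency_mat E vs = mat (length vs) (length vs)
     (\<lambda>(i, j). if {vs ! i, vs ! j} \<in> E then 1 else 0)"

definition laplacian_mat :: "'a set set \<Rightarrow> 'a list \<Rightarrow> real mat" where
  "laplacian_mat E vs = degree_mat E vs - adjacency_mat E vs"

text \<open>The real eigenvalues, repeated according to their multiplicity as roots of the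
  characteristic polynomial, in non-increasing order and numbered from 1. For a symmetric real
  matrix of dimension \<open>n\<close> these are all the eigenvalues, so the meaningful indices are \<open>1\<close>
  to \<open>n\<close>.\<close>

definition eigenvalues_desc :: "real mat \<Rightarrow> real list" where
  "eigenvalues_desc A = rev (sorted_list_of_multiset (proots (char_poly A)))"

definition nth_eigenvalue :: "real mat \<Rightarrow> nat \<Rightarrow> real" where
  "nth_eigenvalue A i = eigenvalues_desc A ! (i - 1)"

end

theory Submission
  imports Defs "Jordan_Normal_Form.Schur_Decomposition" "HOL-Analysis.Convex"
begin

text \<open>
  The middle quantity \<open>T\<close> is a trace: the \<open>m + 1\<close> vectors consisting of the unit vectors
  \<open>e\<^sub>u\<close> for \<open>u \<in> U\<close> and the normalised indicator vector of the complement of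
  \<open>U\<close> are orthonormal, their Rayleigh quotients with respect to \<open>L\<close> are the degrees
  \<open>d\<^sub>u\<close> and \<open>\<bar>\<partial>(U, V - U)\<bar> / (n - m)\<close>, and so \<open>T\<close> is the trace of
  \<open>P L\<close>, where \<open>P\<close> is the orthogonal projection onto their span. In an orthonormal
  eigenbasis \<open>x\<^sub>i\<close> of \<open>L\<close> this trace is the sum of the \<open>p\<^sub>i \<lambda>\<^sub>i\<close>
  with weights \<open>p\<^sub>i = \<langle>x\<^sub>i, P x\<^sub>i\<rangle>\<close> that lie in \<open>[0, 1]\<close> and add up
  to the rank \<open>m + 1\<close>. Such a weighted sum is least when the weight sits on the
  \<open>m + 1\<close> smallest eigenvalues. One of these, \<open>\<lambda>\<^sub>n\<close>, is nonnegative and can be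
  dropped, which gives the lower bound.

  Bounding the same sum from above would allow one eigenvalue too many. But the all-ones vector lies
  in the span and is annihilated by \<open>L\<close>, so subtracting from \<open>P\<close> the projection onto
  it changes the rank to \<open>m\<close> and leaves the trace \<open>T\<close> as it is. The new weights
  \<open>q\<^sub>i\<close> lie again in \<open>[0, 1]\<close> and add up to \<open>m\<close>, so \<open>T\<close> is at
  most the sum of the \<open>m\<close> largest eigenvalues.

  The weights and their comparison with the extreme eigenvalues are the content of
  \<open>zero_row_sum_trace_bounds\<close> and \<open>weighted_sum_le_sum_of_largest\<close>. The eigenbasis,
  matched with the list of roots of the characteristic polynomial, comes from
  \<open>symmetric_eigenbasis\<close>, that is, from the spectral theorem for real symmetric matrices.
\<close>

section \<open>The spectral theorem for real symmetric matrices\<close>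

text \<open>Over the complex numbers the characteristic polynomial splits. If \<open>a\<close> is an eigenvalue
  with eigenvector \<open>v\<close>, then by symmetry the number \<open>\<langle>A v, v\<rangle> = a \<langle>v, v\<rangle>\<close> is its
  own conjugate, so \<open>a\<close> is real, and the complex factorization is the image of a real one.\<close>

lemma real_symmetric_char_poly_splits:
  fixes A :: "real mat"
  assumes A: "A \<in> carrier_mat n n" and sym: "A\<^sup>T = A"
  obtains es where "char_poly A = (\<Prod>e\<leftarrow>es. [:- e, 1:])"
proof -
  let ?C = "map_mat complex_of_real A"
  have C: "?C \<in> carrier_mat n n" using A by simp
  interpret of_real_poly_hom: map_poly_inj_comm_ring_hom complex_of_real ..
  obtain as where as: "char_poly ?C = (\<Prod>a\<leftarrow>as. [:- a, 1:])"
    using char_poly_factorized[OF C] by blast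
  have entry: "A $$ (i, j) = A $$ (j, i)" if "i < n" "j < n" for i j
    using that A sym by (metis carrier_matD index_transpose_mat(1))
  have real: "complex_of_real (Re a) = a" if a: "a \<in> set as" for a
  proof -
    have "poly (char_poly ?C) a = 0"
      unfolding as using a by (induction as) auto
    then have "eigenvalue ?C a"
      using eigenvalue_root_char_poly[OF C] by simp
    then obtain v where v: "v \<in> carrier_vec n" "v \<noteq> 0\<^sub>v n" "?C *\<^sub>v v = a \<cdot>\<^sub>v v"
      using C unfolding eigenvalue_def eigenvector_def by auto
    have Cv: "(\<Sum>j<n. of_real (A $$ (i, j)) * v $ j) = a * v $ i" if "i < n" for i
    proof -
      have "(?C *\<^sub>v v) $ i = (\<Sum>j<n. of_real (A $$ (i, j)) * v $ j)"
        using that A v(1) by (auto simp: scalar_prod_def atLeast0LessThan intro!: sum.cong)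
      then show ?thesis using that v by simp
    qed
    define N where "N = (\<Sum>i<n. v $ i * cnj (v $ i))"
    define S where "S = (\<Sum>i<n. \<Sum>j<n. of_real (A $$ (i, j)) * v $ j * cnj (v $ i))"
    have "S = (\<Sum>i<n. (\<Sum>j<n. of_real (A $$ (i, j)) * v $ j) * cnj (v $ i))"
      unfolding S_def by (simp add: sum_distrib_right)
    also have "\<dots> = a * N"
      unfolding N_def sum_distrib_left by (rule sum.cong) (simp_all add: Cv)
    finally have "S = a * N" .
    moreover have "cnj S = S"
      unfolding S_def cnj_sum by (subst sum.swap) (auto intro!: sum.cong simp: entry)
    moreover have "cnj N = N"
      unfolding N_def by (simp add: mult.commute)
    ultimately have eq: "cnj a * N = a * N"
      by (metis complex_cnj_mult)
    have "N \<noteq> 0"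
    proof
      assume "N = 0"
      then have "complex_of_real (\<Sum>i<n. (norm (v $ i))\<^sup>2) = 0"
        unfolding N_def by (simp only: complex_norm_square of_real_sum)
      then have "\<forall>i<n. v $ i = 0"
        by (simp only: of_real_eq_0_iff) (auto simp: sum_nonneg_eq_0_iff)
      then have "v = 0\<^sub>v n" using v(1) by auto
      then show False using v(2) by simp
    qed
    then have "cnj a = a" using eq by simp
    then show ?thesis by (simp add: complex_eq_iff)
  qed
  have "map_poly complex_of_real (char_poly A) = char_poly ?C"
    by (rule of_real_hom.char_poly_hom[OF A, symmetric])
  also have "\<dots> = (\<Prod>a\<leftarrow>as. map_poly complex_of_real [:- Re a, 1:])"
    unfolding as using real by (auto intro!: arg_cong[of _ _ prod_list])
  also have "\<dots> = map_poly complex_of_real (\<Prod>a\<leftarrow>as. [:- Re a, 1:])"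
    by (simp add: of_real_poly_hom.hom_prod_list o_def)
  also have "\<dots> = map_poly complex_of_real (\<Prod>a\<leftarrow>map Re as. [:- a, 1:])"
    by (simp add: o_def)
  finally have "char_poly A = (\<Prod>a\<leftarrow>map Re as. [:- a, 1:])"
    by (simp only: of_real_poly_hom.eq_iff)
  then show ?thesis by (rule that)
qed

text \<open>Complete the vector to a basis, orthogonalise by Gram-Schmidt, which keeps the first vector,
  and normalise the result.\<close>

lemma orthogonal_matrix_with_first_column:
  fixes v :: "real vec"
  assumes v: "v \<in> carrier_vec n" and norm: "v \<bullet> v = 1"
  obtains W where "W \<in> carrier_mat n n" "W\<^sup>T * W = 1\<^sub>m n" "col W 0 = v"
proof -
  interpret cof_vec_space n "TYPE(real)" .
  define b where "b = basis_completion v"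
  define ws where "ws = gram_schmidt n b"
  have v0: "v \<noteq> 0\<^sub>v n" using norm by auto
  then have n: "0 < n" using v by (metis carrier_vecD gr0I vec_of_dim_0 )
  note b = basis_completion[OF v v0, folded b_def]
  have "b \<noteq> []" using b(6) n by auto
  then have bv: "b = v # tl b" using b(7) by (cases b) auto
  have hd: "hd ws = v"
    unfolding ws_def by (subst bv) (rule gram_schmidt_hd[OF v])
  have ws: "set ws \<subseteq> carrier_vec n" "corthogonal ws" "length ws = n"
    using gram_schmidt_result[OF b(2,4,5) ws_def] b(6) by auto
  have conj [simp]: "conjugate x = x" for x :: "real vec" by (intro eq_vecI) auto
  have orth: "ws ! i \<bullet> ws ! j = 0 \<longleftrightarrow> i \<noteq> j" if "i < n" "j < n" for i j
    using ws(2,3) that unfolding corthogonal_def by auto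
  have carr: "ws ! i \<in> carrier_vec n" if "i < n" for i using ws(1,3) that by auto
  define us where "us = map (\<lambda>w. (1 / sqrt (w \<bullet> w)) \<cdot>\<^sub>v w) ws"
  have us: "us ! i = (1 / sqrt (ws ! i \<bullet> ws ! i)) \<cdot>\<^sub>v ws ! i" "us ! i \<in> carrier_vec n"
    if "i < n" for i
    using that ws(3) carr[OF that] unfolding us_def by auto
  have len: "length us = n" using ws(3) by (simp add: us_def)
  have pos: "0 < ws ! i \<bullet> ws ! i" if "i < n" for i
  proof -
    have "0 \<le> ws ! i \<bullet> ws ! i" by (simp add: scalar_prod_def sum_nonneg)
    moreover have "ws ! i \<bullet> ws ! i \<noteq> 0" using orth that by blast
    ultimately show ?thesis by simp
  qed
  have on: "us ! i \<bullet> us ! j = (if i = j then 1 else 0)" if "i < n" "j < n" for i j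
    using that carr[of i] carr[of j] orth[of i j] pos[of i] by (auto simp: us abs_of_pos)
  define W where "W = mat_of_cols n us"
  have W: "W \<in> carrier_mat n n" unfolding W_def using len by auto
  have cW: "col W i = us ! i" if "i < n" for i
    unfolding W_def using that us(2) len by simp
  have "W\<^sup>T * W = 1\<^sub>m n"
    using W by (intro eq_matI) (auto simp: cW on)
  moreover have "ws ! 0 = v"
    using hd ws(3) n by (metis hd_conv_nth length_0_conv less_numeral_extra(3))
  then have "col W 0 = v"
    using n norm by (simp add: cW us)
  ultimately show ?thesis using W that by blast
qed

text \<open>Induction on the list of roots. An orthogonal change of coordinates makes a unit eigenvector
  for the first root the first basis vector; the matrix stays symmetric, so with its first column its
  first row is cleared too, and the remaining block is symmetric with the remaining roots.\<close>

lemma real_symmetric_orthogonally_diagonalizable: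
  fixes A :: "real mat"
  assumes "A \<in> carrier_mat n n" and "A\<^sup>T = A"
    and "char_poly A = (\<Prod>e\<leftarrow>es. [:- e, 1:])"
  shows "\<exists>P \<in> carrier_mat n n. P\<^sup>T * P = 1\<^sub>m n \<and> P\<^sup>T * A * P = mat_diag n ((!) es)"
  using assms
proof (induction es arbitrary: n A)
  case Nil
  then have "n = 0" using degree_monic_char_poly[of A n] by simp
  then show ?case
    using Nil(1) by (intro bexI[of _ "1\<^sub>m 0"]) (auto intro!: eq_matI simp: mat_diag_def)
next
  case (Cons e es)
  note A = Cons.prems(1) and sym = Cons.prems(2) and cp = Cons.prems(3)
  have "poly (char_poly A) e = 0" by (simp add: cp)
  then have "eigenvalue A e" using eigenvalue_root_char_poly[OF A] by simp
  then obtain v where v: "v \<in> carrier_vec n" "v \<noteq> 0\<^sub>v n" "A *\<^sub>v v = e \<cdot>\<^sub>v v"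
    using A unfolding eigenvalue_def eigenvector_def by auto
  define u where "u = (1 / sqrt (v \<bullet> v)) \<cdot>\<^sub>v v"
  have u: "u \<in> carrier_vec n" using v(1) by (simp add: u_def)
  have "v \<bullet> v \<noteq> 0"
    using conjugate_square_eq_0_vec[OF v(1)] v(2) by (simp add: scalar_prod_def)
  moreover have "0 \<le> v \<bullet> v" by (simp add: scalar_prod_def sum_nonneg)
  ultimately have uu: "u \<bullet> u = 1" using v(1) by (simp add: u_def)
  have Au: "A *\<^sub>v u = e \<cdot>\<^sub>v u"
    unfolding u_def using A v by (simp add: mult_mat_vec smult_smult_assoc mult.commute)
  obtain W where W: "W \<in> carrier_mat n n" "W\<^sup>T * W = 1\<^sub>m n" "col W 0 = u"
    using orthogonal_matrix_with_first_column[OF u uu] by blast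
  have WT: "W\<^sup>T \<in> carrier_mat n n" using W(1) by simp
  have WWT: "W * W\<^sup>T = 1\<^sub>m n"
    using mat_mult_left_right_inverse[OF WT W(1,2)] .
  have "n \<noteq> 0" using v by auto
  then obtain k where n: "n = Suc k" using not0_implies_Suc by blast
  define A' where "A' = W\<^sup>T * A * W"
  have A': "A' \<in> carrier_mat n n" using A W by (simp add: A'_def)
  have A'_sym: "A'\<^sup>T = A'"
    unfolding A'_def using A W(1) sym
    by (simp add: transpose_mult[of _ n n _ n] assoc_mult_mat[of _ n n _ n _ n])
  have A'_swap: "A' $$ (i, j) = A' $$ (j, i)" if "i < n" "j < n" for i j
    using that A' A'_sym by (metis carrier_matD index_transpose_mat(1))
  have A'_col: "A' $$ (i, 0) = (if i = 0 then e else 0)" if i: "i < n" for i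
  proof -
    have "A' $$ (i, 0) = (W\<^sup>T * (A * W)) $$ (i, 0)"
      unfolding A'_def using A W(1) by (simp add: assoc_mult_mat[of _ n n _ n _ n])
    also have "\<dots> = col W i \<bullet> (A *\<^sub>v col W 0)"
      using i n A W(1) by (simp add: mult_mat_vec_def)
    also have "\<dots> = e * (col W i \<bullet> col W 0)"
      using i W u by (simp add: Au W(3) scalar_prod_smult_distrib[of _ n])
    also have "col W i \<bullet> col W 0 = (W\<^sup>T * W) $$ (i, 0)"
      using i n W(1) by simp
    also have "\<dots> = (if i = 0 then 1 else 0)"
      unfolding W(2) using i n by simp
    finally show ?thesis by simp
  qed
  define A3 where "A3 = mat k k (\<lambda>(i, j). A' $$ (Suc i, Suc j))"
  have A3: "A3 \<in> carrier_mat k k" by (simp add: A3_def)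
  have A3_sym: "A3\<^sup>T = A3"
    by (rule eq_matI) (auto simp: A3_def A'_swap n)
  define E where "E = mat 1 1 (\<lambda>_. e)"
  have E: "E \<in> carrier_mat 1 1" by (simp add: E_def)
  have block: "A' = four_block_mat E (0\<^sub>m 1 k) (0\<^sub>m k 1) A3"
  proof (rule eq_matI)
    fix i j
    assume "i < dim_row (four_block_mat E (0\<^sub>m 1 k) (0\<^sub>m k 1) A3)"
      and "j < dim_col (four_block_mat E (0\<^sub>m 1 k) (0\<^sub>m k 1) A3)"
    then have "i < n" "j < n" using E A3 n by auto
    then show "A' $$ (i, j) = four_block_mat E (0\<^sub>m 1 k) (0\<^sub>m k 1) A3 $$ (i, j)"
      using A'_col[of i] A'_col[of j] A'_swap[of i j] n
      by (cases i; cases j) (auto simp: E_def A3_def)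
  qed (use A' E A3 n in auto)
  have "similar_mat_wit A' A (W\<^sup>T) W"
    by (rule similar_mat_witI[OF W(2) WWT A'_def A' A WT W(1)])
  then have "char_poly A' = char_poly A"
    by (intro char_poly_similar) (auto simp: similar_mat_def)
  moreover have "char_poly A' = char_poly E * char_poly A3"
    unfolding block by (rule char_poly_four_block_zeros_col[OF E _ A3]) simp
  moreover have "char_poly E = [:- e, 1:]"
    by (simp add: E_def char_poly_defs det_def sign_def)
  ultimately have "[:- e, 1:] * char_poly A3 = [:- e, 1:] * (\<Prod>e\<leftarrow>es. [:- e, 1:])"
    using cp by simp
  then have "char_poly A3 = (\<Prod>e\<leftarrow>es. [:- e, 1:])"
    by (metis mult_cancel_left pCons_eq_0_iff zero_neq_one)
  from Cons.IH[OF A3 A3_sym this] obtain P' where P': "P' \<in> carrier_mat k k"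
    "P'\<^sup>T * P' = 1\<^sub>m k" "P'\<^sup>T * A3 * P' = mat_diag k ((!) es)" by blast
  define Q where "Q = four_block_mat (1\<^sub>m 1) (0\<^sub>m 1 k) (0\<^sub>m k 1) P'"
  have Q: "Q \<in> carrier_mat n n"
    unfolding Q_def n using four_block_carrier_mat[OF _ P'(1), of "1\<^sub>m 1" 1 1] by simp
  have QT: "Q\<^sup>T = four_block_mat (1\<^sub>m 1) (0\<^sub>m 1 k) (0\<^sub>m k 1) (P'\<^sup>T)"
    unfolding Q_def using P'(1) by (subst transpose_four_block_mat[of _ 1 1 _ k _ k]) auto
  have P'T: "P'\<^sup>T \<in> carrier_mat k k" using P'(1) by simp
  have QTQ: "Q\<^sup>T * Q = 1\<^sub>m n"
    unfolding QT unfolding Q_def n using P' P'T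
    by (subst mult_four_block_mat[of _ 1 1 _ k _ k]) auto
  have QA: "Q\<^sup>T * A' * Q = four_block_mat E (0\<^sub>m 1 k) (0\<^sub>m k 1) (mat_diag k ((!) es))"
    unfolding QT block unfolding Q_def P'(3)[symmetric] using P' P'T E A3
    by (simp add: mult_four_block_mat[of _ 1 1 _ k _ k _ _ 1 _ k])
  have D: "\<dots> = mat_diag n ((!) (e # es))"
    by (rule eq_matI) (auto simp: mat_diag_def E_def n)
  have "(W * Q)\<^sup>T * (W * Q) = Q\<^sup>T * (W\<^sup>T * W) * Q"
    using W(1) Q by (simp add: transpose_mult[of _ n n _ n] assoc_mult_mat[of _ n n _ n _ n])
  then have 1: "(W * Q)\<^sup>T * (W * Q) = 1\<^sub>m n"
    using Q by (simp add: W(2) QTQ)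
  have "(W * Q)\<^sup>T * A * (W * Q) = Q\<^sup>T * A' * Q"
    unfolding A'_def using A W(1) Q
    by (simp add: transpose_mult[of _ n n _ n] assoc_mult_mat[of _ n n _ n _ n])
  then have 2: "(W * Q)\<^sup>T * A * (W * Q) = mat_diag n ((!) (e # es))"
    by (simp only: QA D)
  show ?case using 1 2 W(1) Q by (intro bexI[of _ "W * Q"]) auto
qed

text \<open>The link between the diagonalization, which works with any list of roots, and the
  eigenvalues in non-increasing order: a list of roots is determined up to order.\<close>

lemma eigenvalues_desc_factorization:
  fixes A :: "real mat"
  assumes A: "A \<in> carrier_mat n n" and sym: "A\<^sup>T = A"
  shows "char_poly A = (\<Prod>e\<leftarrow>eigenvalues_desc A. [:- e, 1:])"
    and "length (eigenvalues_desc A) = n"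
    and "\<And>i j. i \<le> j \<Longrightarrow> j < n \<Longrightarrow> eigenvalues_desc A ! j \<le> eigenvalues_desc A ! i"
proof -
  obtain es where es: "char_poly A = (\<Prod>e\<leftarrow>es. [:- e, 1:])"
    using real_symmetric_char_poly_splits[OF A sym] .
  have nz: "(\<Prod>e\<leftarrow>es'. [:- e, 1:]) \<noteq> 0" for es' :: "real list"
    by (auto simp: prod_list_zero_iff)
  have "proots (\<Prod>e\<leftarrow>es'. [:- e, 1:]) = mset es'" for es' :: "real list"
  proof (induction es')
    case (Cons a es')
    have "proots ([:- a, 1:] * (\<Prod>e\<leftarrow>es'. [:- e, 1:]))
        = proots [:- a, 1:] + proots (\<Prod>e\<leftarrow>es'. [:- e, 1:])"
      using nz by (intro proots_mult) auto
    then show ?case using Cons.IH by simp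
  qed simp
  then have mset: "mset (eigenvalues_desc A) = mset es"
    by (simp add: eigenvalues_desc_def es)
  then show cp: "char_poly A = (\<Prod>e\<leftarrow>eigenvalues_desc A. [:- e, 1:])"
    unfolding es by (metis (no_types, lifting) mset_map prod_mset_prod_list)
  show len: "length (eigenvalues_desc A) = n"
    using degree_monic_char_poly[OF A] degree_linear_factors[of uminus "eigenvalues_desc A"]
    by (simp add: cp[symmetric])
  have "sorted (rev (eigenvalues_desc A))" by (simp add: eigenvalues_desc_def)
  then show "eigenvalues_desc A ! j \<le> eigenvalues_desc A ! i" if "i \<le> j" "j < n" for i j
    using that len by (simp add: sorted_rev_iff_nth_mono)
qed

text \<open>The diagonalization in coordinates, with \<open>x i\<close> the unit eigenvector of the \<open>i\<close>-th
  largest eigenvalue, counted from 0. The second property says that the rows of the eigenvector matrix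
  are orthonormal; this is what determines the totals of the weights below.\<close>

lemma symmetric_eigenbasis:
  fixes A :: "real mat"
  assumes A: "A \<in> carrier_mat n n" and sym: "A\<^sup>T = A"
  obtains x :: "nat \<Rightarrow> nat \<Rightarrow> real" where
    "\<And>i. i < n \<Longrightarrow> (\<Sum>j<n. (x i j)\<^sup>2) = 1"
    "\<And>j k. j < n \<Longrightarrow> k < n \<Longrightarrow> (\<Sum>i<n. x i j * x i k) = (if j = k then 1 else 0)"
    "\<And>j k. j < n \<Longrightarrow> k < n \<Longrightarrow>
      A $$ (j, k) = (\<Sum>i<n. eigenvalues_desc A ! i * (x i j * x i k))"
    "\<And>i. i < n \<Longrightarrow>
      eigenvalues_desc A ! i = (\<Sum>j<n. \<Sum>k<n. A $$ (j, k) * (x i j * x i k))"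
proof -
  let ?l = "eigenvalues_desc A"
  obtain P where P: "P \<in> carrier_mat n n" "P\<^sup>T * P = 1\<^sub>m n" "P\<^sup>T * A * P = mat_diag n ((!) ?l)"
    using real_symmetric_orthogonally_diagonalizable
      [OF A sym eigenvalues_desc_factorization(1)[OF A sym]] by blast
  have PT: "P\<^sup>T \<in> carrier_mat n n" using P(1) by simp
  have PPT: "P * P\<^sup>T = 1\<^sub>m n" using mat_mult_left_right_inverse[OF PT P(1,2)] .
  have "P * mat_diag n ((!) ?l) * P\<^sup>T = (P * P\<^sup>T) * A * (P * P\<^sup>T)"
    unfolding P(3)[symmetric] using P(1) A by (simp add: assoc_mult_mat[of _ n n _ n _ n])
  then have dec: "P * mat_diag n ((!) ?l) * P\<^sup>T = A" using A by (simp add: PPT)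
  show ?thesis
  proof (rule that[of "\<lambda>i j. P $$ (j, i)"])
    fix i assume i: "i < n"
    have "(\<Sum>j<n. (P $$ (j, i))\<^sup>2) = (P\<^sup>T * P) $$ (i, i)"
      using i P(1) by (auto simp: scalar_prod_def atLeast0LessThan power2_eq_square)
    then show "(\<Sum>j<n. (P $$ (j, i))\<^sup>2) = 1" using i by (simp add: P(2))
    have "?l ! i = (P\<^sup>T * A * P) $$ (i, i)" using i by (simp add: P(3) mat_diag_def)
    also have "\<dots> = (\<Sum>j<n. \<Sum>k<n. A $$ (j, k) * (P $$ (j, i) * P $$ (k, i)))"
      using i P(1) A
      by (auto simp: scalar_prod_def atLeast0LessThan sum_distrib_left mult.commute mult.left_commute
           intro!: sum.cong)
    finally show "?l ! i = (\<Sum>j<n. \<Sum>k<n. A $$ (j, k) * (P $$ (j, i) * P $$ (k, i)))" .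
  next
    fix j k assume jk: "j < n" "k < n"
    have "(\<Sum>i<n. P $$ (j, i) * P $$ (k, i)) = (P * P\<^sup>T) $$ (j, k)"
      using jk P(1) by (auto simp: scalar_prod_def atLeast0LessThan)
    then show "(\<Sum>i<n. P $$ (j, i) * P $$ (k, i)) = (if j = k then 1 else 0)"
      using jk by (simp add: PPT)
    have "(P * mat_diag n ((!) ?l) * P\<^sup>T) $$ (j, k)
        = (\<Sum>i<n. ?l ! i * (P $$ (j, i) * P $$ (k, i)))"
      using jk P(1)
      by (auto simp: mat_diag_mult_right scalar_prod_def atLeast0LessThan intro!: sum.cong)
    then show "A $$ (j, k) = (\<Sum>i<n. ?l ! i * (P $$ (j, i) * P $$ (k, i)))"
      by (simp add: dec)
  qed
qed

section \<open>Trace bounds from spectral weights\<close>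

text \<open>Moving to the weight that is 1 on \<open>S\<close> and 0 elsewhere keeps the total and raises the
  weight only where \<open>f\<close> is at least \<open>c\<close>, lowering it only where \<open>f\<close> is at most
  \<open>c\<close>. Applied to \<open>- f\<close>, this is the bound from below by the smallest values.\<close>

lemma weighted_sum_le_sum_of_largest:
  fixes f w :: "'i \<Rightarrow> real"
  assumes I: "finite I" "S \<subseteq> I"
    and f: "\<And>i. i \<in> S \<Longrightarrow> c \<le> f i" "\<And>i. i \<in> I - S \<Longrightarrow> f i \<le> c"
    and w: "\<And>i. i \<in> I \<Longrightarrow> 0 \<le> w i" "\<And>i. i \<in> I \<Longrightarrow> w i \<le> 1"
    and total: "sum w I = real (card S)"
  shows "(\<Sum>i\<in>I. w i * f i) \<le> sum f S"
proof -
  define h where "h i = (if i \<in> S then 1 else 0 :: real)" for i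
  have "(\<Sum>i\<in>I. h i * f i) = (\<Sum>i\<in>I. if i \<in> S then f i else 0)"
    by (rule sum.cong) (auto simp: h_def)
  also have "\<dots> = sum f S"
    using I by (simp add: sum.If_cases Int_absorb1)
  finally have hf: "(\<Sum>i\<in>I. h i * f i) = sum f S" .
  have "sum h I = real (card S)"
    using I by (simp add: h_def sum.If_cases Int_absorb1)
  then have "(\<Sum>i\<in>I. w i * f i) - (\<Sum>i\<in>I. h i * f i) = (\<Sum>i\<in>I. (w i - h i) * (f i - c))"
    using total by (simp add: algebra_simps sum.distrib sum_subtractf sum_distrib_left[symmetric])
  also have "\<dots> \<le> 0"
  proof (rule sum_nonpos)
    fix i assume "i \<in> I"
    then show "(w i - h i) * (f i - c) \<le> 0"
      using f[of i] w[of i] by (cases "i \<in> S") (auto simp: h_def mult_le_0_iff)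
  qed
  finally show ?thesis by (simp add: hf)
qed

text \<open>The two-term Cauchy-Schwarz inequality in Engel form; the difference of the two sides is a
  square over a positive number.\<close>

lemma sum_squared_over_sum_le:
  fixes a b s t :: real
  assumes "0 < s" "0 < t"
  shows "(a + b)\<^sup>2 / (s + t) \<le> a\<^sup>2 / s + b\<^sup>2 / t"
proof -
  have "a\<^sup>2 / s + b\<^sup>2 / t - (a + b)\<^sup>2 / (s + t) = (t * a - s * b)\<^sup>2 / (s * t * (s + t))"
    using assms by (simp add: divide_simps) (simp add: algebra_simps power2_eq_square)
  also have "\<dots> \<ge> 0" using assms by simp
  finally show ?thesis by simp
qed

text \<open>Here \<open>B\<close> is a symmetric matrix with zero row sums, given together with its spectral
  decomposition; the eigenvalues \<open>l\<close> are numbered from 0, so \<open>l (n - 1)\<close> is the least one.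
  The number \<open>T\<close> is the trace of \<open>P B\<close>, where \<open>P\<close> projects onto the span of the
  unit vectors indexed by \<open>J\<close> and of the indicator vector of the complement \<open>K\<close>. The
  weights in the proof are \<open>p i = \<langle>x i, P (x i)\<rangle>\<close> and
  \<open>q i = \<langle>x i, (P - Z) (x i)\<rangle>\<close>, where \<open>Z\<close> projects onto the all-ones vector. As
  \<open>Z\<close> is annihilated by \<open>B\<close>, both weights produce \<open>T\<close>, with totals \<open>m + 1\<close>
  and \<open>m\<close>.\<close>

lemma zero_row_sum_trace_bounds:
  fixes B :: "nat \<Rightarrow> nat \<Rightarrow> real" and l :: "nat \<Rightarrow> real" and x :: "nat \<Rightarrow> nat \<Rightarrow> real"
  assumes norm: "\<And>i. i < n \<Longrightarrow> (\<Sum>j<n. (x i j)\<^sup>2) = 1"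
    and dual: "\<And>j k. j < n \<Longrightarrow> k < n \<Longrightarrow> (\<Sum>i<n. x i j * x i k) = (if j = k then 1 else 0)"
    and spectral: "\<And>j k. j < n \<Longrightarrow> k < n \<Longrightarrow> B j k = (\<Sum>i<n. l i * (x i j * x i k))"
    and desc: "\<And>i j. i \<le> j \<Longrightarrow> j < n \<Longrightarrow> l j \<le> l i"
    and least: "0 \<le> l (n - 1)"
    and rows: "\<And>j. j < n \<Longrightarrow> (\<Sum>k<n. B j k) = 0"
    and J: "J \<subseteq> {..<n}" "card J = m" "0 < m" "m < n"
  defines "T \<equiv> (\<Sum>j\<in>J. B j j) + (\<Sum>j\<in>{..<n} - J. \<Sum>k\<in>{..<n} - J. B j k) / (real n - real m)"
  shows "sum l {n - 1 - m..<n - 1} \<le> T" and "T \<le> sum l {..<m}"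
proof -
  define K where "K = {..<n} - J"
  define r where "r = real n - real m"
  have finJ: "finite J" and finK: "finite K" and K: "K \<subseteq> {..<n}" "J \<inter> K = {}" "J \<union> K = {..<n}"
    using J(1) finite_subset by (auto simp: K_def)
  have r: "0 < r" "real (card K) = r"
    using J card_Diff_subset[OF finJ J(1)] by (auto simp: K_def r_def)
  have split: "(\<Sum>j<n. g j) = sum g J + sum g K" for g :: "nat \<Rightarrow> real"
    using sum.union_disjoint[OF finJ finK K(2), of g] K(3) by simp
  have quad: "(\<Sum>i<n. c i * (\<Sum>j\<in>S. x i j)\<^sup>2) = (\<Sum>j\<in>S. \<Sum>k\<in>S. \<Sum>i<n. c i * (x i j * x i k))"
    for c and S :: "nat set"
  proof -
    have "(\<Sum>i<n. c i * (\<Sum>j\<in>S. x i j)\<^sup>2) = (\<Sum>i<n. \<Sum>j\<in>S. \<Sum>k\<in>S. c i * (x i j * x i k))"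
      unfolding power2_eq_square sum_product by (simp only: sum_distrib_left)
    also have "\<dots> = (\<Sum>j\<in>S. \<Sum>i<n. \<Sum>k\<in>S. c i * (x i j * x i k))"
      by (rule sum.swap)
    also have "\<dots> = (\<Sum>j\<in>S. \<Sum>k\<in>S. \<Sum>i<n. c i * (x i j * x i k))"
      by (intro sum.cong refl sum.swap)
    finally show ?thesis .
  qed
  have quadB: "(\<Sum>i<n. l i * (\<Sum>j\<in>S. x i j)\<^sup>2) = (\<Sum>j\<in>S. \<Sum>k\<in>S. B j k)" if "S \<subseteq> {..<n}" for S
    unfolding quad using that by (intro sum.cong refl) (simp add: spectral subset_iff)
  have quad1: "(\<Sum>i<n. (\<Sum>j\<in>S. x i j)\<^sup>2) = real (card S)" if "S \<subseteq> {..<n}" for S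
  proof -
    have "finite S" using that finite_subset by auto
    moreover have "(\<Sum>i<n. (\<Sum>j\<in>S. x i j)\<^sup>2) = (\<Sum>j\<in>S. \<Sum>k\<in>S. if j = k then 1 else 0)"
      using quad[of "\<lambda>_. 1" S] that by (auto simp: dual subset_iff intro!: sum.cong)
    ultimately show ?thesis by simp
  qed
  define p where "p i = (\<Sum>j\<in>J. (x i j)\<^sup>2) + (\<Sum>j\<in>K. x i j)\<^sup>2 / r" for i
  define q where "q i = p i - (\<Sum>j<n. x i j)\<^sup>2 / n" for i
  have pT: "(\<Sum>i<n. p i * l i) = T"
  proof -
    have "(\<Sum>i<n. \<Sum>j\<in>J. l i * (x i j)\<^sup>2) = (\<Sum>j\<in>J. \<Sum>i<n. l i * (x i j)\<^sup>2)"
      by (rule sum.swap)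
    also have "\<dots> = (\<Sum>j\<in>J. B j j)"
      using J(1) by (intro sum.cong refl) (simp add: spectral power2_eq_square subset_iff)
    finally have 1: "(\<Sum>i<n. \<Sum>j\<in>J. l i * (x i j)\<^sup>2) = (\<Sum>j\<in>J. B j j)" .
    have "(\<Sum>i<n. p i * l i)
        = (\<Sum>i<n. \<Sum>j\<in>J. l i * (x i j)\<^sup>2) + (\<Sum>i<n. l i * (\<Sum>j\<in>K. x i j)\<^sup>2) / r"
      unfolding p_def sum_divide_distrib sum.distrib[symmetric]
      by (intro sum.cong refl) (simp add: sum_distrib_left[symmetric] algebra_simps)
    then show ?thesis
      unfolding 1 quadB[OF K(1)] by (simp only: T_def r_def K_def)
  qed
  have qT: "(\<Sum>i<n. q i * l i) = T"
  proof -
    have "(\<Sum>i<n. q i * l i) = (\<Sum>i<n. p i * l i) - (\<Sum>i<n. l i * (\<Sum>j<n. x i j)\<^sup>2) / n"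
      unfolding q_def sum_divide_distrib sum_subtractf[symmetric]
      by (intro sum.cong refl) (simp add: algebra_simps)
    then show ?thesis using quadB[of "{..<n}"] rows by (simp add: pT)
  qed
  have p_sum: "sum p {..<n} = m + 1"
  proof -
    have "(\<Sum>i<n. \<Sum>j\<in>J. (x i j)\<^sup>2) = (\<Sum>j\<in>J. \<Sum>i<n. x i j * x i j)"
      unfolding power2_eq_square by (rule sum.swap)
    also have "\<dots> = real m" using J by (simp add: dual subset_iff)
    finally show ?thesis
      using quad1[OF K(1)] r by (simp add: p_def sum.distrib sum_divide_distrib[symmetric])
  qed
  have q_sum: "sum q {..<n} = m"
    using quad1[of "{..<n}"] J p_sum
    by (simp add: q_def sum_subtractf sum_divide_distrib[symmetric])
  (* Cauchy-Schwarz on K: a projection does not increase the norm. *)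
  have p_le: "p i \<le> 1" if "i < n" for i
  proof -
    have "(\<Sum>j\<in>K. x i j)\<^sup>2 \<le> (\<Sum>j\<in>K. (x i j)\<^sup>2) * r"
      using sum_squared_le_sum_of_squares[of "x i" K] r by simp
    then have "(\<Sum>j\<in>K. x i j)\<^sup>2 / r \<le> (\<Sum>j\<in>K. (x i j)\<^sup>2)"
      using r by (simp add: divide_le_eq)
    then show ?thesis using norm[OF that] by (simp add: p_def split)
  qed
  (* The all-ones vector lies in the range of P, so P - Z is positive semidefinite. *)
  have q_ge: "0 \<le> q i" for i
  proof -
    have "(\<Sum>j\<in>J. x i j)\<^sup>2 / m \<le> (\<Sum>j\<in>J. (x i j)\<^sup>2)"
      using sum_squared_le_sum_of_squares[of "x i" J] J by (simp add: divide_le_eq)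
    moreover have "(\<Sum>j<n. x i j)\<^sup>2 / n \<le> (\<Sum>j\<in>J. x i j)\<^sup>2 / m + (\<Sum>j\<in>K. x i j)\<^sup>2 / r"
      using sum_squared_over_sum_le[of m r] J(3) r(1) by (simp add: split r_def)
    ultimately show ?thesis by (simp add: q_def p_def)
  qed
  have q_le: "q i \<le> p i" for i by (simp add: q_def)
  have "(\<Sum>i<n. q i * l i) \<le> sum l {..<m}"
  proof (rule weighted_sum_le_sum_of_largest[where c = "l (m - 1)"])
    show "q i \<le> 1" if "i \<in> {..<n}" for i
      using order_trans[OF q_le p_le] that by simp
  qed (use J q_ge q_sum in \<open>auto intro!: desc\<close>)
  then show "T \<le> sum l {..<m}" by (simp add: qT)
  (* The weights p have total m + 1, so they give one eigenvalue more than required: the least one. *)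
  have "(\<Sum>i<n. p i * - l i) \<le> (\<Sum>i\<in>{n - 1 - m..<n}. - l i)"
  proof (rule weighted_sum_le_sum_of_largest[where c = "- l (n - 1 - m)"])
    show "0 \<le> p i" for i using order_trans[OF q_ge q_le] .
    show "sum p {..<n} = real (card {n - 1 - m..<n})"
      using J p_sum by simp
  qed (use J p_le in \<open>auto intro!: desc\<close>)
  then have "sum l {n - 1 - m..<n} \<le> T"
    using pT by (simp add: sum_negf)
  moreover have "sum l {n - 1 - m..<n} = sum l {n - 1 - m..<n - 1} + l (n - 1)"
  proof -
    have "n = Suc (n - 1)" using J by simp
    then show ?thesis
      by (metis J(4) diff_le_self sum.atLeastLessThan_Suc)
  qed
  ultimately show "sum l {n - 1 - m..<n - 1} \<le> T" using least by simp
qed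

section \<open>Laplacian matrices of graphs\<close>

lemma degree_in_eq_sum:
  assumes G: "simple_graph V E" and u: "u \<in> V"
  shows "real (degree_in E u) = (\<Sum>v\<in>V. if {u, v} \<in> E then 1 else 0)"
proof -
  have fin: "finite V" and E: "\<forall>e\<in>E. e \<subseteq> V \<and> card e = 2"
    using G unfolding simple_graph_def by blast+
  have "{e \<in> E. u \<in> e} = (\<lambda>v. {u, v}) ` {v \<in> V. {u, v} \<in> E}"
  proof (intro equalityI subsetI)
    fix e assume e: "e \<in> {e \<in> E. u \<in> e}"
    then have "card e = 2" "e \<subseteq> V" using E by auto
    then obtain x y where xy: "e = {x, y}" by (auto simp: card_2_iff)
    then obtain v where "e = {u, v}" using e by blast
    then show "e \<in> (\<lambda>v. {u, v}) ` {v \<in> V. {u, v} \<in> E}"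
      using e \<open>e \<subseteq> V\<close> by auto
  qed auto
  moreover have "inj_on (\<lambda>v. {u, v}) {v \<in> V. {u, v} \<in> E}"
    by (auto simp: inj_on_def doubleton_eq_iff)
  ultimately have "degree_in E u = card {v \<in> V. {u, v} \<in> E}"
    unfolding degree_in_def by (simp add: card_image)
  then show ?thesis
    using fin by (simp add: sum.If_cases Int_def)
qed

lemma card_edges_between_eq_sum:
  assumes "finite U" "finite W" and disj: "U \<inter> W = {}"
  shows "real (card (edges_between E U W)) = (\<Sum>u\<in>U. \<Sum>w\<in>W. if {u, w} \<in> E then 1 else 0)"
proof -
  let ?P = "{(u, w) \<in> U \<times> W. {u, w} \<in> E}"
  have "edges_between E U W = (\<lambda>(u, w). {u, w}) ` ?P"
    unfolding edges_between_def by auto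
  moreover have "inj_on (\<lambda>(u, w). {u, w}) ?P"
    using disj by (auto simp: inj_on_def doubleton_eq_iff)
  ultimately have "card (edges_between E U W) = card ?P"
    by (simp add: card_image)
  also have "real \<dots> = (\<Sum>p\<in>U \<times> W. if {fst p, snd p} \<in> E then 1 else 0)"
  proof -
    have "?P = (U \<times> W) \<inter> {p. {fst p, snd p} \<in> E}" by auto
    then show ?thesis using assms(1,2) by (simp add: sum.If_cases)
  qed
  also have "\<dots> = (\<Sum>u\<in>U. \<Sum>w\<in>W. if {u, w} \<in> E then 1 else 0)"
    by (simp add: sum.cartesian_product case_prod_unfold)
  finally show ?thesis .
qed

text \<open>The form is half the sum of the \<open>a j k * (y j - y k)\<^sup>2\<close>.\<close>

lemma laplacian_form_nonneg:
  fixes a :: "nat \<Rightarrow> nat \<Rightarrow> real"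
  assumes sym: "\<And>j k. j < n \<Longrightarrow> k < n \<Longrightarrow> a j k = a k j"
    and nonneg: "\<And>j k. j < n \<Longrightarrow> k < n \<Longrightarrow> 0 \<le> a j k"
  shows "0 \<le> (\<Sum>j<n. \<Sum>k<n. ((if j = k then \<Sum>i<n. a j i else 0) - a j k) * (y j * y k))"
    (is "0 \<le> ?Q")
proof -
  have 1: "?Q = (\<Sum>j<n. \<Sum>k<n. a j k * (y j)\<^sup>2) - (\<Sum>j<n. \<Sum>k<n. a j k * (y j * y k))"
  proof -
    have "(\<Sum>k<n. (if j = k then \<Sum>i<n. a j i else 0) * (y j * y k)) = (\<Sum>k<n. a j k * (y j)\<^sup>2)"
      if "j < n" for j
    proof -
      have "(\<Sum>k<n. (if j = k then \<Sum>i<n. a j i else 0) * (y j * y k))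
          = (\<Sum>k<n. if j = k then (\<Sum>i<n. a j i) * (y j)\<^sup>2 else 0)"
        by (rule sum.cong) (auto simp: power2_eq_square)
      then show ?thesis using that by (simp add: sum_distrib_right)
    qed
    then show ?thesis by (simp add: left_diff_distrib sum_subtractf)
  qed
  have 2: "(\<Sum>j<n. \<Sum>k<n. a j k * (y k)\<^sup>2) = (\<Sum>j<n. \<Sum>k<n. a j k * (y j)\<^sup>2)"
    by (subst sum.swap, intro sum.cong refl arg_cong2[of _ _ _ _ times] sym) auto
  have "(\<Sum>j<n. \<Sum>k<n. a j k * (y j - y k)\<^sup>2)
      = (\<Sum>j<n. \<Sum>k<n. a j k * (y j)\<^sup>2 + a j k * (y k)\<^sup>2 - 2 * (a j k * (y j * y k)))"
    by (intro sum.cong refl) (simp add: power2_diff algebra_simps)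
  also have "\<dots> = (\<Sum>j<n. \<Sum>k<n. a j k * (y j)\<^sup>2) + (\<Sum>j<n. \<Sum>k<n. a j k * (y k)\<^sup>2)
        - 2 * (\<Sum>j<n. \<Sum>k<n. a j k * (y j * y k))"
    by (simp only: sum.distrib sum_subtractf sum_distrib_left)
  finally have "(\<Sum>j<n. \<Sum>k<n. a j k * (y j - y k)\<^sup>2)
      = (\<Sum>j<n. \<Sum>k<n. a j k * (y j)\<^sup>2) + (\<Sum>j<n. \<Sum>k<n. a j k * (y k)\<^sup>2)
        - 2 * (\<Sum>j<n. \<Sum>k<n. a j k * (y j * y k))" .
  moreover have "0 \<le> (\<Sum>j<n. \<Sum>k<n. a j k * (y j - y k)\<^sup>2)"
    by (intro sum_nonneg mult_nonneg_nonneg nonneg) auto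
  ultimately show ?thesis using 1 2 by simp
qed

text \<open>Translates sums over matrix indices into sums over vertices.\<close>

lemma bij_betw_nth_preimage:
  assumes "distinct vs" "S \<subseteq> set vs"
  shows "bij_betw ((!) vs) {j. j < length vs \<and> vs ! j \<in> S} S"
proof (rule bij_betw_imageI)
  show "inj_on ((!) vs) {j. j < length vs \<and> vs ! j \<in> S}"
    using assms(1) by (simp add: inj_on_def nth_eq_iff_index_eq)
  show "(!) vs ` {j. j < length vs \<and> vs ! j \<in> S} = S"
  proof (intro equalityI subsetI)
    fix v assume "v \<in> S"
    moreover from this obtain j where "j < length vs" "vs ! j = v"
      using assms(2) in_set_conv_nth[of v vs] by auto
    ultimately show "v \<in> (!) vs ` {j. j < length vs \<and> vs ! j \<in> S}" by auto
  qed auto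
qed

section \<open>The bounds for Laplacian eigenvalues\<close>

theorem theorem2p1:
  fixes V U :: "'a set" and E :: "'a set set" and vs :: "'a list"
    and L :: "real mat" and n m :: nat
  assumes "simple_graph V E" and "connected_graph V E" and "card V = n"
    and "distinct vs" and "set vs = V" and "L = laplacian_mat E vs"
    and "U \<subseteq> V" and "card U = m" and "0 < m" and "m < n"
  shows "(\<Sum>i = 1..m. nth_eigenvalue L (n - i))
           \<le> (\<Sum>u\<in>U. real (degree_in E u))
               + real (card (edges_between E U (V - U))) / (real n - real m)
       \<and> (\<Sum>u\<in>U. real (degree_in E u))
               + real (card (edges_between E U (V - U))) / (real n - real m)
           \<le> (\<Sum>i = 1..m. nth_eigenvalue L i)"
proof -
  note G = assms(1) and vs = assms(4,5) and L_def = assms(6) and U = assms(7-10)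
  have fin: "finite V" and noloop: "{u} \<notin> E" for u
    using G unfolding simple_graph_def by (blast, force)
  have n: "length vs = n" using distinct_card[OF vs(1)] vs(2) assms(3) by simp
  define a where "a u v = (if {u, v} \<in> E then 1 else 0 :: real)" for u v
  have a_sym: "a u v = a v u" for u v by (simp add: a_def insert_commute)
  have deg: "real (degree_in E u) = sum (a u) V" if "u \<in> V" for u
    using degree_in_eq_sum[OF G that] by (simp add: a_def)
  have nthV: "vs ! j \<in> V" if "j < n" for j using that n vs by auto
  have sum_nth: "(\<Sum>j\<in>{j. j < n \<and> vs ! j \<in> S}. f (vs ! j)) = sum f S" if "S \<subseteq> V"
    for S and f :: "'a \<Rightarrow> real"
    using sum.reindex_bij_betw[OF bij_betw_nth_preimage[of vs S], of f] that vs n by simp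
  have sum_all: "(\<Sum>j<n. f (vs ! j)) = sum f V" for f :: "'a \<Rightarrow> real"
  proof -
    have "{j. j < n \<and> vs ! j \<in> V} = {..<n}" using nthV by auto
    then show ?thesis using sum_nth[of V f] by simp
  qed
  have L: "L \<in> carrier_mat n n"
    unfolding L_def laplacian_mat_def degree_mat_def adjacency_mat_def n
    by (intro minus_carrier_mat mat_carrier)
  have Ljk: "L $$ (j, k) = (if j = k then \<Sum>i<n. a (vs ! j) (vs ! i) else 0) - a (vs ! j) (vs ! k)"
    if "j < n" "k < n" for j k
  proof -
    have "(\<Sum>i<n. a (vs ! j) (vs ! i)) = real (degree_in E (vs ! j))"
      using sum_all[of "a (vs ! j)"] deg[OF nthV[OF that(1)]] by simp
    then show ?thesis
      using that n
      unfolding L_def laplacian_mat_def degree_mat_def adjacency_mat_def by (auto simp: a_def)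
  qed
  have L_sym: "L\<^sup>T = L"
    using L by (intro eq_matI) (auto simp: Ljk a_sym)
  have rows: "(\<Sum>k<n. L $$ (j, k)) = 0" if "j < n" for j
    using that by (simp add: Ljk sum_subtractf)
  define J where "J = {j. j < n \<and> vs ! j \<in> U}"
  have J: "J \<subseteq> {..<n}" by (auto simp: J_def)
  have "bij_betw ((!) vs) J U"
    unfolding J_def using bij_betw_nth_preimage[of vs U] vs n U(1) by simp
  then have card_J: "card J = m" using U(2) bij_betw_same_card by metis
  define K where "K = {..<n} - J"
  have K: "K = {j. j < n \<and> vs ! j \<in> V - U}" using nthV by (auto simp: K_def J_def)
  have diag: "(\<Sum>j\<in>J. L $$ (j, j)) = (\<Sum>u\<in>U. real (degree_in E u))"
  proof -
    have "(\<Sum>j\<in>J. L $$ (j, j)) = (\<Sum>j\<in>J. real (degree_in E (vs ! j)))"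
      by (rule sum.cong)
         (auto simp: J_def Ljk sum_all deg[OF nthV] noloop a_def[of u u for u])
    also have "\<dots> = (\<Sum>u\<in>U. real (degree_in E u))"
      unfolding J_def by (rule sum_nth[OF U(1)])
    finally show ?thesis .
  qed
  have cut: "(\<Sum>j\<in>K. \<Sum>k\<in>K. L $$ (j, k)) = real (card (edges_between E U (V - U)))"
  proof -
    (* The row sums vanish, so the entries inside K cancel those leading from K to J. *)
    have "(\<Sum>k\<in>K. L $$ (j, k)) = (\<Sum>u\<in>U. a u (vs ! j))" if "j \<in> K" for j
    proof -
      have j: "j < n" "j \<notin> J" using that by (auto simp: K_def)
      have "(\<Sum>k\<in>K. L $$ (j, k)) = - (\<Sum>k\<in>J. L $$ (j, k))"
        using rows[OF j(1)] sum.subset_diff[OF J, of "\<lambda>k. L $$ (j, k)"] by (simp add: K_def)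
      also have "\<dots> = (\<Sum>k\<in>J. a (vs ! k) (vs ! j))"
        unfolding sum_negf[symmetric] using j J
        by (intro sum.cong refl) (auto simp: Ljk a_sym)
      also have "\<dots> = (\<Sum>u\<in>U. a u (vs ! j))"
        unfolding J_def by (rule sum_nth[OF U(1)])
      finally show ?thesis .
    qed
    then have "(\<Sum>j\<in>K. \<Sum>k\<in>K. L $$ (j, k)) = (\<Sum>j\<in>K. \<Sum>u\<in>U. a u (vs ! j))" by simp
    also have "\<dots> = (\<Sum>w\<in>V - U. \<Sum>u\<in>U. a u w)"
      unfolding K by (rule sum_nth) (rule Diff_subset)
    also have "\<dots> = (\<Sum>u\<in>U. \<Sum>w\<in>V - U. a u w)" by (rule sum.swap)
    also have "\<dots> = real (card (edges_between E U (V - U)))"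
      using card_edges_between_eq_sum[of U "V - U" E] fin finite_subset[OF U(1) fin]
      by (simp add: a_def)
    finally show ?thesis .
  qed
  have top: "(\<Sum>i = 1..m. nth_eigenvalue L i) = (\<Sum>i<m. eigenvalues_desc L ! i)"
    unfolding nth_eigenvalue_def
    by (rule sum.reindex_bij_witness[of _ Suc "\<lambda>i. i - 1"]) auto
  have bottom: "(\<Sum>i = 1..m. nth_eigenvalue L (n - i))
      = (\<Sum>i\<in>{n - 1 - m..<n - 1}. eigenvalues_desc L ! i)"
    unfolding nth_eigenvalue_def using U(4)
    by (intro sum.reindex_bij_witness[of _ "\<lambda>i. n - 1 - i" "\<lambda>i. n - 1 - i"]) auto
  show ?thesis
  proof (rule symmetric_eigenbasis[OF L L_sym])
    fix x :: "nat \<Rightarrow> nat \<Rightarrow> real"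
    assume x: "\<And>i. i < n \<Longrightarrow> (\<Sum>j<n. (x i j)\<^sup>2) = 1"
      "\<And>j k. j < n \<Longrightarrow> k < n \<Longrightarrow> (\<Sum>i<n. x i j * x i k) = (if j = k then 1 else 0)"
      "\<And>j k. j < n \<Longrightarrow> k < n \<Longrightarrow>
        L $$ (j, k) = (\<Sum>i<n. eigenvalues_desc L ! i * (x i j * x i k))"
      "\<And>i. i < n \<Longrightarrow>
        eigenvalues_desc L ! i = (\<Sum>j<n. \<Sum>k<n. L $$ (j, k) * (x i j * x i k))"
    (* The least eigenvalue is the value of the Laplacian form at its unit eigenvector. *)
    have least: "0 \<le> eigenvalues_desc L ! (n - 1)"
    proof -
      let ?y = "x (n - 1)"
      have "eigenvalues_desc L ! (n - 1) = (\<Sum>j<n. \<Sum>k<n. ((if j = k then \<Sum>i<n. a (vs ! j) (vs ! i) else 0)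
          - a (vs ! j) (vs ! k)) * (?y j * ?y k))"
        using U(4) by (subst x(4)) (auto simp: Ljk intro!: sum.cong)
      also have "\<dots> \<ge> 0"
        by (rule laplacian_form_nonneg) (auto simp: a_sym, simp add: a_def)
      finally show ?thesis .
    qed
    show ?thesis
      unfolding top bottom diag[symmetric] cut[symmetric] K_def
      using zero_row_sum_trace_bounds[where B = "\<lambda>j k. L $$ (j, k)" and l = "(!) (eigenvalues_desc L)",
          OF x(1-3) eigenvalues_desc_factorization(3)[OF L L_sym] least rows J card_J U(3,4)]
      by (intro conjI)
  qed
qed

end
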